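(* Let $\mathbf p\in\mathbb P(\mathcal X)$ and $L_{\lim}\in[1,\infty)$, and consider the problem of minimizing $\mathbb L(\mathbf l,\mathbf p)=\sum_{x\in\mathcal X}l(x)p(x)$ over $\mathbf l\in\mathcal L(\mathbb R_+^{|\mathcal X|})$ subject to $\max_{x\in\mathcal X}l(x)\le L_{\lim}$. With $\alpha_k$, $\mathcal U_k$ as in the context, the optimal real-valued prefix code length vector is $$l^\dagger_\alpha(x)=\begin{cases}-\log\big((1-\alpha)p(x)\big), & x\in\mathcal U_k^c,\\[4pt] -\log\Big(\dfrac{\alpha+(1-\alpha)\sum_{y\in\mathcal U_k}p(y)}{|\mathcal U_k|}\Big), & x\in\mathcal U_k,\end{cases}$$ where $$\alpha=\begin{cases}0, & \text{if } -\log p(x_{|\mathcal X|})\le L_{\lim},\\[4pt] 1-\dfrac{1-|\mathcal U_k|D^{-L_{\lim}}}{\sum_{x\in\mathcal U_k^c}p(x)}, & \text{if } -\log\Big(\dfrac{\sum_{x\in\mathcal X}p(x)}{|\mathcal X|}\Big)<L_{\lim}\le-\log p(x_{|\mathcal X|}),\\[8pt] \alpha_{\max}, & \text{if } L_{\lim}=-\log\Big(\dfrac{\sum_{x\in\mathcal X}p(x)}{|\mathcal X|}\Big),\end{cases}$$ and $k\in\{0,\dots,|\mathcal X|-1\}$ is the index for which $\alpha\in[\alpha_k,\alpha_{k+1})$ (in the second case $k\le|\mathcal X|-2$, and $k$ is the index for which the value $\alpha$ given by the displayed formula lies in $[\alpha_k,\alpha_{k+1})$). If $L_{\lim}<-\log\Big(\frac{\sum_{x\in\mathcal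 X}p(x)}{|\mathcal X|}\Big)$, the problem has no feasible solution.
   Context: Let $D\ge 2$ be an integer and $\log=\log_D$. Let $\mathcal X=\{x_1,\dots,x_{|\mathcal X|}\}$ be a finite alphabet and let $\mathbb P(\mathcal X)$ be the set of probability vectors $\mathbf p=(p(x_1),\dots,p(x_{|\mathcal X|}))$ with $p(x_1)\ge p(x_2)\ge\dots\ge p(x_{|\mathcal X|})>0$ and $\sum_x p(x)=1$ (so $-\log(\sum_xp(x)/|\mathcal X|)=\log|\mathcal X|$). Real-valued prefix code length vectors are the elements of $\mathcal L(\mathbb R_+^{|\mathcal X|})=\{\mathbf l\in\mathbb R_+^{|\mathcal X|}:\sum_{x\in\mathcal X}D^{-l(x)}\le 1\}$, where $\mathbb R_+=[0,\infty)$. For $k\in\{0,\dots,|\mathcal X|-1\}$ let $\mathcal U_k=\{x_{|\mathcal X|-k},\dots,x_{|\mathcal X|}\}$ (so $|\mathcal U_k|=k+1$) and $\mathcal U_k^c=\mathcal X\setminus\mathcal U_k$. The numbers $\alpha_k$ are given by $\alpha_0=0$, the recursion $$\alpha_{k+1}=\alpha_k+(1-\alpha_k)\,\frac{p(x_{|\mathcal X|-(k+1)})-p(x_{|\mathcal X|-k})}{\dfrac{\sum_{y\in\mathcal U_k^c}p(y)}{|\mathcal U_k|}+p(x_{|\mathcal X|-(k+1)})},\qquad 0\le k\le|\mathcal X|-2,$$ and the convention $\alpha_{|\mathcal X|}=1$; one has $0=\alpha_0\le\alpha_1\le\dots\le\alpha_{|\mathcal X|}=1$, and $[a,b)=\emptyset$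 if $a=b$. Also $\alpha_{\max}=1-\frac{1}{|\mathcal X|p(x_1)}$. *)

theory Defs
  imports Complex_Main
begin

text \<open>
  The alphabet is a finite set \<open>X\<close> of letters, listed as \<open>x 1, \<dots>, x (card X)\<close> by an
  enumeration \<open>x\<close> with \<open>bij_betw x {1..card X} X\<close>. Vectors indexed by the alphabet are
  functions \<open>'a \<Rightarrow> real\<close>, of which only the values on \<open>X\<close> matter.
\<close>

definition prob_vectors :: "'a set \<Rightarrow> (nat \<Rightarrow> 'a) \<Rightarrow> ('a \<Rightarrow> real) set" where
  "prob_vectors X x =
     {p. (\<forall>i. 1 \<le> i \<and> i < card X \<longrightarrow> p (x (Suc i)) \<le> p (x i)) \<and>
         (\<forall>a\<in>X. 0 < p a) \<and> (\<Sum>a\<in>X. p a) = 1}"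

definition code_lengths :: "nat \<Rightarrow> 'a set \<Rightarrow> ('a \<Rightarrow> real) set" where
  "code_lengths D X = {l. (\<forall>a\<in>X. 0 \<le> l a) \<and> (\<Sum>a\<in>X. real D powr (- l a)) \<le> 1}"

definition avg_length :: "'a set \<Rightarrow> ('a \<Rightarrow> real) \<Rightarrow> ('a \<Rightarrow> real) \<Rightarrow> real" where
  "avg_length X l p = (\<Sum>a\<in>X. l a * p a)"

definition limited_code_lengths :: "nat \<Rightarrow> 'a set \<Rightarrow> real \<Rightarrow> ('a \<Rightarrow> real) set" where
  "limited_code_lengths D X L = {l \<in> code_lengths D X. Max (l ` X) \<le> L}"

text \<open>
  \<open>l\<close> is the optimal vector: it solves the length-limited problem, and, as a vector indexed
  by \<open>X\<close>, it is the only solution.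
\<close>

definition is_optimal_code ::
    "nat \<Rightarrow> 'a set \<Rightarrow> ('a \<Rightarrow> real) \<Rightarrow> real \<Rightarrow> ('a \<Rightarrow> real) \<Rightarrow> bool" where
  "is_optimal_code D X p L l \<longleftrightarrow>
     (\<forall>l'. is_arg_min (\<lambda>m. avg_length X m p) (\<lambda>m. m \<in> limited_code_lengths D X L) l'
           \<longleftrightarrow> (\<forall>a\<in>X. l' a = l a))"

text \<open>The sets \<open>U\<^sub>k\<close> of the last \<open>k + 1\<close> letters, used for \<open>k < card X\<close>.\<close>

definition U :: "'a set \<Rightarrow> (nat \<Rightarrow> 'a) \<Rightarrow> nat \<Rightarrow> 'a set" where
  "U X x k = x ` {card X - k..card X}"

text \<open>The breakpoints \<open>\<alpha>\<^sub>k\<close>; the first branch is the convention at index \<open>card X\<close>.\<close>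

primrec alpha_seq :: "'a set \<Rightarrow> (nat \<Rightarrow> 'a) \<Rightarrow> ('a \<Rightarrow> real) \<Rightarrow> nat \<Rightarrow> real" where
  "alpha_seq X x p 0 = 0"
| "alpha_seq X x p (Suc k) =
     (if card X \<le> Suc k then 1
      else alpha_seq X x p k + (1 - alpha_seq X x p k) *
             ((p (x (card X - (k + 1))) - p (x (card X - k))) /
              ((\<Sum>y\<in>X - U X x k. p y) / real (card (U X x k)) + p (x (card X - (k + 1))))))"

definition alpha_max :: "'a set \<Rightarrow> (nat \<Rightarrow> 'a) \<Rightarrow> ('a \<Rightarrow> real) \<Rightarrow> real" where
  "alpha_max X x p = 1 - 1 / (real (card X) * p (x 1))"

definition alpha_lim ::
    "nat \<Rightarrow> 'a set \<Rightarrow> (nat \<Rightarrow> 'a) \<Rightarrow> ('a \<Rightarrow> real) \<Rightarrow> real \<Rightarrow> nat \<Rightarrow> real" where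
  "alpha_lim D X x p L k =
     1 - (1 - real (card (U X x k)) * real D powr (- L)) / (\<Sum>a\<in>X - U X x k. p a)"

definition is_alpha_index ::
    "'a set \<Rightarrow> (nat \<Rightarrow> 'a) \<Rightarrow> ('a \<Rightarrow> real) \<Rightarrow> real \<Rightarrow> nat \<Rightarrow> bool" where
  "is_alpha_index X x p \<alpha> k \<longleftrightarrow>
     k < card X \<and> \<alpha> \<in> {alpha_seq X x p k..<alpha_seq X x p (Suc k)}"

definition l_dagger ::
    "nat \<Rightarrow> 'a set \<Rightarrow> (nat \<Rightarrow> 'a) \<Rightarrow> ('a \<Rightarrow> real) \<Rightarrow> real \<Rightarrow> nat \<Rightarrow> 'a \<Rightarrow> real" where
  "l_dagger D X x p \<alpha> k a =
     (if a \<in> U X x k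
      then - log (real D) ((\<alpha> + (1 - \<alpha>) * (\<Sum>y\<in>U X x k. p y)) / real (card (U X x k)))
      else - log (real D) ((1 - \<alpha>) * p a))"

end

theory Submission
  imports Defs
begin

text \<open>
  A feasible vector \<open>l = - log Q\<close> with \<open>\<Sum> Q = 1\<close> is the unique optimum as soon as, for some
  \<open>\<beta> > 0\<close>, every letter has \<open>Q = \<beta> p\<close>, or \<open>Q \<ge> \<beta> p\<close> and \<open>l = L\<close>: replacing \<open>p\<close> by \<open>Q / \<beta>\<close>
  only decreases the difference of the costs of a competitor and of \<open>l\<close>, and the
  remaining difference is a relative entropy. With \<open>\<beta> = 1 - \<alpha>\<close> this is what \<open>l\<^sup>\<dagger>\<close> satisfies.

  The recursion for \<open>\<alpha>\<^sub>k\<close> has the closed form \<open>1 - \<alpha>\<^sub>k = 1 / T\<^sub>k\<close> with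
  \<open>T\<^sub>k = \<Sum>\<^bsub>U\<^sub>k\<^sup>c\<^esub> p + (k + 1) p (x\<^bsub>n - k\<^esub>)\<close>, where \<open>n\<close> is the size of the alphabet. In these terms
  the condition that the value \<open>\<alpha>\<close> computed from \<open>k\<close> and \<open>L\<close> lies between \<open>\<alpha>\<^sub>k\<close> and \<open>\<alpha>\<^bsub>k+1\<^esub>\<close>
  reads \<open>r\<^sub>k \<le> D\<^bsup>-L\<^esup> < r\<^bsub>k+1\<^esub>\<close> for the nondecreasing sequence \<open>r\<^sub>k = p (x\<^bsub>n - k\<^esub>) / T\<^sub>k\<close>, which
  runs from \<open>p (x\<^sub>n)\<close> to \<open>1 / n\<close>.
\<close>

section \<open>Locating a value between consecutive terms of a nondecreasing sequence\<close>

text \<open>The index is the predecessor of the first \<open>j\<close> with \<open>w < r j\<close>;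
  monotonicity makes the half-open steps disjoint. It is applied to the breakpoints and later to the
  sequence of thresholds for the length limit.\<close>

lemma ex1_step_of_mono:
  fixes r :: "nat \<Rightarrow> real"
  assumes mono: "\<And>k. k < m \<Longrightarrow> r k \<le> r (Suc k)"
    and "r 0 \<le> w" "w < r m"
  shows "\<exists>!k. k < m \<and> r k \<le> w \<and> w < r (Suc k)"
proof -
  have le: "r i \<le> r j" if "i \<le> j" "j \<le> m" for i j
    using that
  proof (induction j rule: dec_induct)
    case (step n)
    then show ?case using mono[of n] by simp
  qed simp
  define j where "j = (LEAST j. w < r j)"
  have j: "w < r j" and "j \<le> m"
    unfolding j_def using assms(3) by (auto intro: LeastI Least_le)
  have "j \<noteq> 0"
    using j assms(2) by (metis not_less)
  then obtain k where k: "j = Suc k"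
    using not0_implies_Suc by blast
  have "r k \<le> w"
    using not_less_Least[of k "\<lambda>j. w < r j"] k unfolding j_def by auto
  show ?thesis
  proof (rule ex1I[of _ k])
    show "k < m \<and> r k \<le> w \<and> w < r (Suc k)"
      using \<open>r k \<le> w\<close> j \<open>j \<le> m\<close> k by auto
  next
    fix i assume i: "i < m \<and> r i \<le> w \<and> w < r (Suc i)"
    show "i = k"
    proof (rule ccontr)
      assume "i \<noteq> k"
      then have "Suc i \<le> k \<or> Suc k \<le> i"
        by auto
      then show False
        using le[of "Suc i" k] le[of "Suc k" i] i j k \<open>j \<le> m\<close> \<open>r k \<le> w\<close> by auto
    qed
  qed
qed

section \<open>Relative entropy and the optimality criterion\<close>

text \<open>Equality case of Gibbs' inequality. With z the ratio of \<open>b powr (- m c)\<close> to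
  \<open>Q c\<close>, the bound ln z \<le> z - 1 makes each \<open>g c\<close> nonnegative, while
  the hypotheses make their sum nonpositive. So ln z = z - 1 throughout, which forces z = 1.\<close>

lemma gibbs_eq:
  fixes Q m :: "'a \<Rightarrow> real"
  assumes "1 < b" "finite X" "\<And>a. a \<in> X \<Longrightarrow> 0 < Q a" "(\<Sum>a\<in>X. Q a) = 1"
    and "(\<Sum>a\<in>X. b powr (- m a)) \<le> 1"
    and le: "(\<Sum>a\<in>X. Q a * (m a + log b (Q a))) \<le> 0"
    and "a \<in> X"
  shows "m a = - log b (Q a)"
proof -
  have ln: "ln (b powr (- m c) / Q c) = - ln b * (m c + log b (Q c))" if "c \<in> X" for c
    using assms(1) assms(3)[OF that] by (simp add: ln_div ln_powr log_def field_simps)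
  define g where "g c = b powr (- m c) - Q c + Q c * (ln b * (m c + log b (Q c)))" for c
  have g: "g c = Q c * (b powr (- m c) / Q c - 1 - ln (b powr (- m c) / Q c))" if "c \<in> X" for c
    unfolding g_def ln[OF that] using assms(3)[OF that] by (simp add: field_simps)
  have nonneg: "0 \<le> g c" if "c \<in> X" for c
    unfolding g[OF that] using assms(1) assms(3)[OF that] ln_le_minus_one[of "b powr (- m c) / Q c"]
    by (intro mult_nonneg_nonneg) auto
  have "(\<Sum>c\<in>X. g c) = (\<Sum>c\<in>X. b powr (- m c)) - 1 + ln b * (\<Sum>c\<in>X. Q c * (m c + log b (Q c)))"
    unfolding g_def by (simp add: sum.distrib sum_subtractf assms(4) sum_distrib_left mult_ac)
  also have "\<dots> \<le> 0"
    using assms(1,5) le by (smt (verit) ln_gt_zero mult_nonneg_nonpos)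
  finally have "(\<Sum>c\<in>X. g c) = 0"
    using sum_nonneg[of X g] nonneg by force
  then have "g a = 0"
    using sum_nonneg_eq_0_iff[of X g] nonneg assms(2,7) by blast
  then have "ln (b powr (- m a) / Q a) = b powr (- m a) / Q a - 1"
    using g[OF assms(7)] assms(3)[OF assms(7)] by simp
  then have "b powr (- m a) / Q a = 1"
    using assms(1) assms(3)[OF assms(7)] by (intro ln_eq_minus_one) auto
  then show ?thesis
    using ln[OF assms(7)] assms(1) by simp
qed

lemma mem_limited_code_lengths_iff:
  assumes "finite X" "X \<noteq> {}"
  shows "m \<in> limited_code_lengths D X L \<longleftrightarrow>
    (\<forall>a\<in>X. 0 \<le> m a \<and> m a \<le> L) \<and> (\<Sum>a\<in>X. real D powr (- m a)) \<le> 1"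
  using assms by (auto simp: limited_code_lengths_def code_lengths_def)

lemma is_optimal_codeI:
  fixes Q :: "'a \<Rightarrow> real"
  assumes "2 \<le> D" "finite X" "X \<noteq> {}"
    and Q: "\<And>a. a \<in> X \<Longrightarrow> 0 < Q a" "(\<Sum>a\<in>X. Q a) = 1"
    and l: "\<And>a. a \<in> X \<Longrightarrow> l a = - log (real D) (Q a)" "\<And>a. a \<in> X \<Longrightarrow> l a \<le> L"
    and "0 < \<beta>"
    and slack: "\<And>a. a \<in> X \<Longrightarrow> Q a = \<beta> * p a \<or> \<beta> * p a \<le> Q a \<and> l a = L"
  shows "is_optimal_code D X p L l"
proof -
  let ?F = "limited_code_lengths D X L"
  note iff = mem_limited_code_lengths_iff[OF assms(2,3)]
  have powr: "real D powr (- l a) = Q a" if "a \<in> X" for a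
    using l(1)[OF that] Q(1)[OF that] assms(1) by simp
  have "Q a \<le> 1" if "a \<in> X" for a
    using member_le_sum[of a X Q] that Q assms(2) by (simp add: less_imp_le)
  then have feasible: "l \<in> ?F"
    using l Q assms(1) by (auto simp: iff powr)
  have cost: "\<beta> * (avg_length X m p - avg_length X l p) \<ge> (\<Sum>a\<in>X. Q a * (m a - l a))"
    if m: "m \<in> ?F" for m
  proof -
    have "Q a * (m a - l a) \<le> \<beta> * (m a * p a) - \<beta> * (l a * p a)" if "a \<in> X" for a
    proof -
      \<comment> \<open>Either the first factor vanishes, or it is nonnegative and
        \<open>m a\<close> cannot exceed \<open>l a = L\<close>.\<close>
      have "(Q a - \<beta> * p a) * (m a - l a) \<le> 0"
        using slack[OF that] m that by (auto simp: iff intro: mult_nonneg_nonpos)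
      then show ?thesis
        by (simp add: algebra_simps)
    qed
    then show ?thesis
      unfolding avg_length_def right_diff_distrib sum_distrib_left
      by (simp flip: sum_subtractf) (rule sum_mono, simp add: algebra_simps)
  qed
  \<comment> \<open>A feasible vector that costs no more than \<open>l\<close> is \<open>l\<close>
    on \<open>X\<close>; this yields both minimality and uniqueness.\<close>
  have eq: "\<forall>a\<in>X. m a = l a" if m: "m \<in> ?F" and "avg_length X m p \<le> avg_length X l p" for m
  proof -
    have "(\<Sum>a\<in>X. Q a * (m a - l a)) \<le> 0"
      using cost[OF m] that(2) \<open>0 < \<beta>\<close> by (smt (verit) mult_nonneg_nonpos)
    then have "(\<Sum>a\<in>X. Q a * (m a + log (real D) (Q a))) \<le> 0"
      using l(1) by (simp cong: sum.cong)
    then show ?thesis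
      using gibbs_eq[of "real D" X Q m] assms(1,2) Q m l(1) by (auto simp: iff)
  qed
  show ?thesis
    unfolding is_optimal_code_def
  proof (intro allI iffI)
    fix m assume "is_arg_min (\<lambda>m. avg_length X m p) (\<lambda>m. m \<in> ?F) m"
    then show "\<forall>a\<in>X. m a = l a"
      using feasible by (intro eq) (auto simp: is_arg_min_def not_less)
  next
    fix m assume m: "\<forall>a\<in>X. m a = l a"
    then have "avg_length X m p = avg_length X l p"
      by (simp add: avg_length_def)
    moreover have "m \<in> ?F"
      using feasible m by (simp add: iff)
    moreover have "avg_length X l p \<le> avg_length X m' p" if "m' \<in> ?F" for m'
    proof (rule ccontr)
      assume less: "\<not> avg_length X l p \<le> avg_length X m' p"
      then have "\<forall>a\<in>X. m' a = l a"
        using eq[OF that] by simp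
      then show False
        using less by (simp add: avg_length_def)
    qed
    ultimately show "is_arg_min (\<lambda>m. avg_length X m p) (\<lambda>m. m \<in> ?F) m"
      by (auto simp: is_arg_min_def not_less)
  qed
qed

section \<open>Tail sets, the sums \<open>S\<close> and \<open>T\<close>, and the
  breakpoints\<close>

locale sorted_distribution =
  fixes X :: "'a set" and x :: "nat \<Rightarrow> 'a" and p :: "'a \<Rightarrow> real"
  assumes finite_X: "finite X"
    and bij: "bij_betw x {1..card X} X"
    and p: "p \<in> prob_vectors X x"
begin

definition S :: "nat \<Rightarrow> real" where "S k = (\<Sum>a\<in>X - U X x k. p a)"

definition T :: "nat \<Rightarrow> real" where "T k = S k + real (Suc k) * p (x (card X - k))"

lemma sum_p: "(\<Sum>a\<in>X. p a) = 1"
  and p_pos: "a \<in> X \<Longrightarrow> 0 < p a"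
  using p by (auto simp: prob_vectors_def)

lemma card_pos: "0 < card X"
  using sum_p finite_X by (auto simp: card_gt_0_iff)

lemma nonempty: "X \<noteq> {}"
  using card_pos by auto

lemma x_in: "1 \<le> i \<Longrightarrow> i \<le> card X \<Longrightarrow> x i \<in> X"
  using bij by (auto simp: bij_betw_def)

lemma inj_x: "A \<subseteq> {1..card X} \<Longrightarrow> inj_on x A"
  using bij by (auto simp: bij_betw_def intro: inj_on_subset)

lemma p_x_antimono:
  assumes "1 \<le> i" "i \<le> j" "j \<le> card X"
  shows "p (x j) \<le> p (x i)"
  using assms(2,3)
proof (induction j rule: dec_induct)
  case (step j)
  then have "p (x (Suc j)) \<le> p (x j)"
    using p assms(1) by (auto simp: prob_vectors_def)
  then show ?case
    using step by simp
qed simp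

lemma U_subset: "k < card X \<Longrightarrow> U X x k \<subseteq> X"
  unfolding U_def using x_in by auto

lemma card_U: "k < card X \<Longrightarrow> card (U X x k) = Suc k"
  unfolding U_def by (subst card_image) (auto intro!: inj_x)

lemma sum_U: "k < card X \<Longrightarrow> (\<Sum>a\<in>U X x k. p a) = 1 - S k"
  using sum.subset_diff[OF U_subset finite_X, of k p] sum_p by (simp add: S_def)

lemma Compl_U: "k < card X \<Longrightarrow> X - U X x k = x ` {1..<card X - k}"
proof -
  assume k: "k < card X"
  have "X - U X x k = x ` {1..card X} - x ` {card X - k..card X}"
    using bij by (simp add: bij_betw_def U_def)
  also have "\<dots> = x ` ({1..card X} - {card X - k..card X})"
    using bij k by (intro inj_on_image_set_diff[symmetric, of x "{1..card X}"])
      (auto simp: bij_betw_def)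
  also have "{1..card X} - {card X - k..card X} = {1..<card X - k}"
    using k by auto
  finally show ?thesis .
qed

lemma S_eq: "k < card X \<Longrightarrow> S k = (\<Sum>i=1..<card X - k. p (x i))"
  unfolding S_def Compl_U by (subst sum.reindex) (auto intro!: inj_x)

lemma S_step:
  assumes "Suc k < card X"
  shows "S k = S (Suc k) + p (x (card X - Suc k))"
proof -
  have "card X - k = Suc (card X - Suc k)" "1 \<le> card X - Suc k"
    using assms by auto
  then show ?thesis
    using assms by (simp add: S_eq)
qed

lemma S_nonneg: "0 \<le> S k"
  unfolding S_def using p_pos by (intro sum_nonneg) (auto intro: less_imp_le)

lemma p_x_diff_pos: "k < card X \<Longrightarrow> 0 < p (x (card X - k))"
  using p_pos x_in by simp

lemma S_pos: "Suc k < card X \<Longrightarrow> 0 < S k"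
  using S_step[of k] S_nonneg[of "Suc k"] p_x_diff_pos[of "Suc k"] by simp

lemma S_last: "S (card X - 1) = 0"
  using card_pos by (simp add: S_eq)

lemma p_x_diff_mono: "Suc k < card X \<Longrightarrow> p (x (card X - k)) \<le> p (x (card X - Suc k))"
  by (rule p_x_antimono) auto

lemma T_pos: "k < card X \<Longrightarrow> 0 < T k"
  unfolding T_def using S_nonneg p_x_diff_pos by (simp add: add_nonneg_pos)

lemma T_0: "T 0 = 1"
proof -
  have "U X x 0 = {x (card X)}"
    by (simp add: U_def)
  then show ?thesis
    using sum_U[of 0] card_pos by (simp add: T_def)
qed

lemma T_last: "T (card X - 1) = real (card X) * p (x 1)"
  using card_pos by (simp add: T_def S_last[simplified])

text \<open>The letter joining the tail set takes its mass back into \<open>S k\<close>, so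
  \<open>T k\<close> and \<open>T (Suc k)\<close> differ only in the probability multiplied by
  \<open>Suc k\<close>.\<close>

lemma T_Suc: "Suc k < card X \<Longrightarrow> T (Suc k) = S k + real (Suc k) * p (x (card X - Suc k))"
  by (simp add: T_def S_step algebra_simps)

lemma T_mono: "Suc k < card X \<Longrightarrow> T k \<le> T (Suc k)"
  unfolding T_Suc using p_x_diff_mono[of k] by (simp add: T_def mult_left_mono)

lemma T_ge_1: "k < card X \<Longrightarrow> 1 \<le> T k"
proof (induction k)
  case (Suc k)
  then show ?case using T_mono[of k] by simp
qed (simp add: T_0)

text \<open>The recursion multiplies \<open>1 - alpha_seq X x p k\<close> by a factor that equals
  \<open>T k / T (Suc k)\<close>, so the product telescopes from \<open>T 0 = 1\<close>.\<close>

lemma one_minus_alpha_seq: "k < card X \<Longrightarrow> 1 - alpha_seq X x p k = 1 / T k"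
proof (induction k)
  case 0
  then show ?case by (simp add: T_0)
next
  case (Suc k)
  let ?q = "p (x (card X - k))" and ?q' = "p (x (card X - Suc k))"
  define d where "d = S k / real (Suc k) + ?q'"
  have d: "d = T (Suc k) / real (Suc k)"
    using Suc.prems by (simp add: d_def T_Suc field_simps)
  have "1 - alpha_seq X x p (Suc k) = (1 - alpha_seq X x p k) * (1 - (?q' - ?q) / d)"
    using Suc.prems card_U[of k] by (simp add: d_def S_def algebra_simps)
  also have "1 - (?q' - ?q) / d = T k / T (Suc k)"
    using T_pos[OF Suc.prems] unfolding d
    by (simp add: field_simps del: of_nat_Suc) (simp add: T_Suc[OF Suc.prems] T_def S_step[OF Suc.prems] algebra_simps)
  also have "(1 - alpha_seq X x p k) * \<dots> = 1 / T (Suc k)"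
    using Suc T_pos[of k] by simp
  finally show ?case .
qed

lemma alpha_seq_eq: "k < card X \<Longrightarrow> alpha_seq X x p k = 1 - 1 / T k"
  using one_minus_alpha_seq[of k] by simp

lemma alpha_seq_card: "alpha_seq X x p (card X) = 1"
  using card_pos by (cases "card X") auto

lemma alpha_seq_mono: "k < card X \<Longrightarrow> alpha_seq X x p k \<le> alpha_seq X x p (Suc k)"
proof (cases "Suc k < card X")
  case True
  then show ?thesis
    unfolding alpha_seq_eq[OF True] using T_mono[OF True] T_pos[of k]
    by (simp add: alpha_seq_eq frac_le del: alpha_seq.simps)
next
  case False
  assume "k < card X"
  then show ?thesis
    using False T_pos[of k] alpha_seq_eq[of k] by simp
qed

lemma ex1_alpha_index:
  assumes "0 \<le> \<alpha>" "\<alpha> < 1"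
  shows "\<exists>!k. is_alpha_index X x p \<alpha> k"
  using ex1_step_of_mono[of "card X" "alpha_seq X x p" \<alpha>] alpha_seq_mono alpha_seq_card assms
  by (simp add: is_alpha_index_def del: alpha_seq.simps(2))

section \<open>Thresholds for the length limit\<close>

text \<open>The common value \<open>D\<^bsup>-l\<^esup>\<close> of \<open>l\<^sup>\<dagger>\<close> on \<open>U\<^sub>k\<close> when \<open>\<alpha> = \<alpha>\<^sub>k\<close>.\<close>

definition r :: "nat \<Rightarrow> real" where "r k = p (x (card X - k)) / T k"

lemma r_0: "r 0 = p (x (card X))"
  by (simp add: r_def T_0)

lemma r_last: "r (card X - 1) = 1 / real (card X)"
proof -
  have "0 < p (x 1)"
    using p_pos x_in card_pos by simp
  then show ?thesis
    using card_pos T_last by (simp add: r_def)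
qed

lemma r_mono:
  assumes k: "Suc k < card X"
  shows "r k \<le> r (Suc k)"
proof -
  let ?q = "p (x (card X - k))" and ?q' = "p (x (card X - Suc k))"
  \<comment> \<open>The products of \<open>?q\<close> and \<open>?q'\<close> cancel, leaving
    \<open>?q * S k \<le> ?q' * S k\<close>.\<close>
  have "?q * T (Suc k) \<le> ?q' * T k"
    using mult_right_mono[OF p_x_diff_mono[OF k] S_nonneg[of k]]
    unfolding T_Suc[OF k] T_def[of k] by (simp add: algebra_simps)
  then show ?thesis
    using T_pos[of k] T_pos[OF k] k by (simp add: r_def field_simps)
qed

lemma alpha_lim_eq:
  "k < card X \<Longrightarrow> alpha_lim D X x p L k = 1 - (1 - real (Suc k) * real D powr (- L)) / S k"
  by (simp add: alpha_lim_def card_U S_def)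

text \<open>Both bounds compare \<open>?\<beta>\<close> with a reciprocal of \<open>T\<close>. With
  \<open>T k\<close> and \<open>T (Suc k)\<close> both written through \<open>S k\<close>, clearing
  denominators cancels \<open>S k\<close> and leaves a bound on \<open>?w\<close>.\<close>

lemma is_alpha_index_alpha_lim_iff:
  assumes k: "Suc k < card X"
  shows "is_alpha_index X x p (alpha_lim D X x p L k) k \<longleftrightarrow>
    r k \<le> real D powr (- L) \<and> real D powr (- L) < r (Suc k)"
proof -
  let ?w = "real D powr (- L)" and ?\<beta> = "(1 - real (Suc k) * real D powr (- L)) / S k"
  let ?q = "p (x (card X - k))" and ?q' = "p (x (card X - Suc k))"
  note pos = S_pos[OF k] T_pos[OF k] T_pos[of k]
  have "?\<beta> \<le> 1 / T k \<longleftrightarrow> (1 - real (Suc k) * ?w) * T k \<le> S k"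
    using pos k by (simp add: field_simps)
  also have "\<dots> \<longleftrightarrow> real (Suc k) * ?q \<le> real (Suc k) * (?w * T k)"
    by (simp add: T_def algebra_simps)
  also have "\<dots> \<longleftrightarrow> r k \<le> ?w"
    using pos k by (simp add: r_def divide_le_eq del: of_nat_Suc)
  finally have lower: "?\<beta> \<le> 1 / T k \<longleftrightarrow> r k \<le> ?w" .
  have "1 / T (Suc k) < ?\<beta> \<longleftrightarrow> S k < (1 - real (Suc k) * ?w) * T (Suc k)"
    using pos by (simp add: field_simps)
  also have "\<dots> \<longleftrightarrow> real (Suc k) * (?w * T (Suc k)) < real (Suc k) * ?q'"
    by (simp add: T_Suc[OF k] algebra_simps)
  also have "\<dots> \<longleftrightarrow> ?w < r (Suc k)"
    using pos by (simp add: r_def less_divide_eq del: of_nat_Suc)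
  finally have upper: "1 / T (Suc k) < ?\<beta> \<longleftrightarrow> ?w < r (Suc k)" .
  have "is_alpha_index X x p (alpha_lim D X x p L k) k \<longleftrightarrow> ?\<beta> \<le> 1 / T k \<and> 1 / T (Suc k) < ?\<beta>"
    using k unfolding is_alpha_index_def
    by (simp add: alpha_lim_eq alpha_seq_eq del: alpha_seq.simps of_nat_Suc)
  then show ?thesis
    using lower upper by simp
qed

section \<open>Optimality of the explicit code lengths, and infeasibility\<close>

text \<open>Here \<open>w\<close> is the common value of \<open>Q\<close> on the tail set. The lower
  bound on \<alpha> gives \<open>Q\<close> \<ge> (1 - \<alpha>) p there; the upper bound makes
  \<open>w\<close> the least value of \<open>Q\<close>, so the longest length is
  \<open>- log (real D) w\<close>.\<close>

lemma l_dagger_optimal: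
  assumes D: "2 \<le> D" and k: "k < card X" and "\<alpha> < 1"
    and lower: "1 - \<alpha> \<le> 1 / T k" and upper: "Suc k < card X \<Longrightarrow> 1 / T (Suc k) < 1 - \<alpha>"
    and w: "w = (1 - (1 - \<alpha>) * S k) / real (Suc k)"
    and L: "- log (real D) w \<le> L"
    and "\<alpha> = 0 \<or> - log (real D) w = L"
  shows "is_optimal_code D X p L (l_dagger D X x p \<alpha> k)"
proof -
  define Q where "Q a = (if a \<in> U X x k then w else (1 - \<alpha>) * p a)" for a
  have w_eq: "(\<alpha> + (1 - \<alpha>) * (\<Sum>y\<in>U X x k. p y)) / real (card (U X x k)) = w"
    by (simp add: sum_U[OF k] card_U[OF k] w algebra_simps)
  have "(1 - \<alpha>) * T k \<le> 1"
    using lower T_pos[OF k] by (simp add: field_simps)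
  then have "(1 - \<alpha>) * p (x (card X - k)) \<le> w"
    by (simp add: w T_def field_simps)
  moreover have "0 < (1 - \<alpha>) * p (x (card X - k))"
    using \<open>\<alpha> < 1\<close> p_x_diff_pos[OF k] by simp
  ultimately have w_ge: "(1 - \<alpha>) * p (x (card X - k)) \<le> w" and w_pos: "0 < w"
    by auto
  have U_le: "(1 - \<alpha>) * p a \<le> w" if "a \<in> U X x k" for a
  proof -
    have "p a \<le> p (x (card X - k))"
      using that k unfolding U_def by (auto intro: p_x_antimono)
    then have "(1 - \<alpha>) * p a \<le> (1 - \<alpha>) * p (x (card X - k))"
      using \<open>\<alpha> < 1\<close> by simp
    then show ?thesis
      using w_ge by simp
  qed
  have compl_ge: "w \<le> (1 - \<alpha>) * p a" if "a \<in> X - U X x k" for a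
  proof -
    obtain i where i: "a = x i" "1 \<le> i" "i < card X - k"
      using \<open>a \<in> X - U X x k\<close> unfolding Compl_U[OF k] by auto
    then have k': "Suc k < card X"
      by simp
    have "1 \<le> (1 - \<alpha>) * T (Suc k)"
      using upper[OF k'] T_pos[OF k'] by (simp add: field_simps)
    then have "w \<le> (1 - \<alpha>) * p (x (card X - Suc k))"
      by (simp add: w T_Suc[OF k'] field_simps)
    also have "\<dots> \<le> (1 - \<alpha>) * p a"
      using i k' \<open>\<alpha> < 1\<close> by (intro mult_left_mono) (auto intro: p_x_antimono)
    finally show ?thesis .
  qed
  have Q_ge: "w \<le> Q a" if "a \<in> X" for a
    using compl_ge that by (simp add: Q_def)
  have Q_pos: "0 < Q a" if "a \<in> X" for a
    using Q_ge[OF that] w_pos by simp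
  have l: "l_dagger D X x p \<alpha> k a = - log (real D) (Q a)" for a
    unfolding l_dagger_def Q_def w_eq by simp
  have U_cap: "X \<inter> U X x k = U X x k"
    using U_subset[OF k] by auto
  have "(\<Sum>a\<in>X. Q a) = (\<Sum>a\<in>U X x k. w) + (\<Sum>a\<in>X - U X x k. (1 - \<alpha>) * p a)"
    unfolding Q_def using finite_X by (simp add: sum.If_cases U_cap Diff_eq)
  also have "\<dots> = real (Suc k) * w + (1 - \<alpha>) * S k"
    by (simp add: card_U[OF k] S_def sum_distrib_left)
  also have "\<dots> = 1"
    by (simp add: w field_simps)
  finally have sum_Q: "(\<Sum>a\<in>X. Q a) = 1" .
  show ?thesis
  proof (rule is_optimal_codeI[OF D finite_X nonempty, where Q = Q and \<beta> = "1 - \<alpha>"])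
    fix a assume a: "a \<in> X"
    have "log (real D) w \<le> log (real D) (Q a)"
      using Q_ge[OF a] w_pos D by simp
    then show "l_dagger D X x p \<alpha> k a \<le> L"
      using L by (simp add: l)
  next
    show "Q a = (1 - \<alpha>) * p a \<or> (1 - \<alpha>) * p a \<le> Q a \<and> l_dagger D X x p \<alpha> k a = L"
      if a: "a \<in> X" for a
    proof (cases "\<alpha> = 0")
      case True
      \<comment> \<open>The limit may be slack in this case, but \<open>Q\<close> dominates
        \<open>p\<close> and both sum to 1 over \<open>X\<close>, so they agree there.\<close>
      have "(\<Sum>b\<in>X. Q b - p b) = 0"
        by (simp add: sum_subtractf sum_Q sum_p)
      moreover have "0 \<le> Q b - p b" for b
        using True U_le[of b] by (simp add: Q_def)
      ultimately have "Q a - p a = 0"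
        using sum_nonneg_eq_0_iff[of X "\<lambda>b. Q b - p b"] finite_X a by blast
      then show ?thesis
        using True by simp
    next
      case False
      then have "- log (real D) w = L"
        using assms(8) by simp
      then show ?thesis
        using U_le[of a] by (simp add: l) (simp add: Q_def)
    qed
  qed (use Q_pos sum_Q l \<open>\<alpha> < 1\<close> in auto)
qed

lemma l_dagger_optimal_of_index:
  assumes "2 \<le> D" and idx: "is_alpha_index X x p \<alpha> k"
    and w: "w = (1 - (1 - \<alpha>) * S k) / real (Suc k)"
    and "- log (real D) w \<le> L"
    and "\<alpha> = 0 \<or> - log (real D) w = L"
  shows "is_optimal_code D X p L (l_dagger D X x p \<alpha> k)"
proof (rule l_dagger_optimal[OF assms(1) _ _ _ _ w assms(4,5)])
  show k: "k < card X"
    using idx by (simp add: is_alpha_index_def)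
  show "1 - \<alpha> \<le> 1 / T k"
    using idx k by (simp add: is_alpha_index_def alpha_seq_eq del: alpha_seq.simps)
  show up: "1 / T (Suc k) < 1 - \<alpha>" if "Suc k < card X"
    using idx that by (simp add: is_alpha_index_def alpha_seq_eq del: alpha_seq.simps)
  show "\<alpha> < 1"
  proof (cases "Suc k < card X")
    case True
    then show ?thesis
      using up T_pos[of "Suc k"] by (smt (verit) zero_less_divide_1_iff)
  next
    case False
    \<comment> \<open>At the last index the upper breakpoint is 1 by convention.\<close>
    then show ?thesis
      using idx by (simp add: is_alpha_index_def)
  qed
qed

text \<open>Lengths bounded by \<open>L\<close> have Kraft sum at least
  \<open>real (card X) * real D powr (- L)\<close>, which exceeds 1 for such
  \<open>L\<close>.\<close>

lemma limited_code_lengths_empty: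
  assumes D: "2 \<le> D" and L: "L < - log (real D) (1 / real (card X))"
  shows "limited_code_lengths D X L = {}"
proof (rule ccontr)
  assume "limited_code_lengths D X L \<noteq> {}"
  then obtain m where m: "\<And>a. a \<in> X \<Longrightarrow> m a \<le> L" "(\<Sum>a\<in>X. real D powr (- m a)) \<le> 1"
    using mem_limited_code_lengths_iff[OF finite_X nonempty] by blast
  have "(\<Sum>a\<in>X. real D powr (- L)) \<le> (\<Sum>a\<in>X. real D powr (- m a))"
    using m(1) D by (intro sum_mono powr_mono) auto
  then have "real (card X) * real D powr (- L) \<le> 1"
    using m(2) by simp
  moreover have "1 / real (card X) < real D powr (- L)"
    using L D card_pos by (simp add: less_powr_iff)
  ultimately show False
    using card_pos by (simp add: field_simps)
qed

end

section \<open>The four ranges of the length limit\<close>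

theorem theorem4:
  fixes D :: nat and X :: "'a set" and x :: "nat \<Rightarrow> 'a"
    and p :: "'a \<Rightarrow> real" and L_lim :: real
  assumes "2 \<le> D"
    and "finite X" and "bij_betw x {1..card X} X"
    and "p \<in> prob_vectors X x"
    and "1 \<le> L_lim"
  shows "(- log (real D) (p (x (card X))) \<le> L_lim \<longrightarrow>
      (\<exists>!k. is_alpha_index X x p 0 k) \<and>
      (\<forall>k. is_alpha_index X x p 0 k \<longrightarrow>
         is_optimal_code D X p L_lim (l_dagger D X x p 0 k))) \<and>
    (- log (real D) ((\<Sum>a\<in>X. p a) / real (card X)) < L_lim \<and>
      L_lim \<le> - log (real D) (p (x (card X))) \<longrightarrow>
      (\<exists>!k. k + 2 \<le> card X \<and> is_alpha_index X x p (alpha_lim D X x p L_lim k) k) \<and>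
      (\<forall>k. k + 2 \<le> card X \<and> is_alpha_index X x p (alpha_lim D X x p L_lim k) k \<longrightarrow>
         is_optimal_code D X p L_lim (l_dagger D X x p (alpha_lim D X x p L_lim k) k))) \<and>
    (L_lim = - log (real D) ((\<Sum>a\<in>X. p a) / real (card X)) \<longrightarrow>
      (\<exists>!k. is_alpha_index X x p (alpha_max X x p) k) \<and>
      (\<forall>k. is_alpha_index X x p (alpha_max X x p) k \<longrightarrow>
         is_optimal_code D X p L_lim (l_dagger D X x p (alpha_max X x p) k))) \<and>
    (L_lim < - log (real D) ((\<Sum>a\<in>X. p a) / real (card X)) \<longrightarrow>
      limited_code_lengths D X L_lim = {})"
proof -
  interpret sorted_distribution X x p
    using assms by unfold_locales
  define w where "w = real D powr (- L_lim)"
  have log_w: "- log (real D) w = L_lim"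
    using assms(1) by (simp add: w_def)
  have w_less_iff: "w < y \<longleftrightarrow> - log (real D) y < L_lim" if "0 < y" for y
    using that assms(1) by (auto simp: w_def powr_less_iff)
  have pn_pos: "0 < p (x (card X))" and p1_pos: "0 < p (x 1)"
    using p_pos x_in card_pos by auto
  have "is_optimal_code D X p L_lim (l_dagger D X x p 0 k)"
    if L: "- log (real D) (p (x (card X))) \<le> L_lim" and idx: "is_alpha_index X x p 0 k" for k
  proof -
    \<comment> \<open>The index need not be 0: ties among the least probabilities make several
      breakpoints vanish. Here \<open>T k \<le> 1\<close>, so the mean of \<open>p\<close> over the
      tail set is at least \<open>p (x (card X - k))\<close>.\<close>
    have k: "k < card X" and "alpha_seq X x p k \<le> 0"
      using idx by (auto simp: is_alpha_index_def)
    then have "1 / T k \<ge> 1"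
      using one_minus_alpha_seq[OF k] by simp
    then have "p (x (card X - k)) \<le> (1 - S k) / real (Suc k)"
      using T_pos[OF k] by (simp add: T_def field_simps)
    moreover have "p (x (card X)) \<le> p (x (card X - k))"
      using k by (intro p_x_antimono) auto
    ultimately have "log (real D) (p (x (card X))) \<le> log (real D) ((1 - S k) / real (Suc k))"
      using assms(1) pn_pos by simp
    then show ?thesis
      using L by (intro l_dagger_optimal_of_index[OF assms(1) idx refl]) auto
  qed
  moreover have
    "\<exists>!k. k + 2 \<le> card X \<and> is_alpha_index X x p (alpha_lim D X x p L_lim k) k"
    if "- log (real D) (1 / real (card X)) < L_lim" "L_lim \<le> - log (real D) (p (x (card X)))"
  proof -
    have "r 0 \<le> w" "w < r (card X - 1)"
      using that w_less_iff[OF pn_pos] w_less_iff[of "1 / real (card X)"] card_pos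
      by (auto simp: r_0 r_last[simplified])
    then have "\<exists>!k. k < card X - 1 \<and> r k \<le> w \<and> w < r (Suc k)"
      using r_mono by (intro ex1_step_of_mono) auto
    moreover have "k + 2 \<le> card X \<and> is_alpha_index X x p (alpha_lim D X x p L_lim k) k \<longleftrightarrow>
        k < card X - 1 \<and> r k \<le> w \<and> w < r (Suc k)" for k
      using is_alpha_index_alpha_lim_iff[of k D L_lim] by (auto simp: w_def)
    ultimately show ?thesis
      by simp
  qed
  moreover have
    "is_optimal_code D X p L_lim (l_dagger D X x p (alpha_lim D X x p L_lim k) k)"
    if k: "k + 2 \<le> card X" and idx: "is_alpha_index X x p (alpha_lim D X x p L_lim k) k" for k
  proof -
    \<comment> \<open>The formula for \<open>alpha_lim\<close> is this equation solved for \<alpha>,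
      so the tail letters get length exactly \<open>L_lim\<close>.\<close>
    have "w = (1 - (1 - alpha_lim D X x p L_lim k) * S k) / real (Suc k)"
      using k S_pos[of k] by (simp add: alpha_lim_eq w_def del: of_nat_Suc)
    then show ?thesis
      using log_w by (intro l_dagger_optimal_of_index[OF assms(1) idx]) auto
  qed
  moreover have alpha_max_eq: "alpha_max X x p = alpha_seq X x p (card X - 1)"
    using alpha_seq_eq[of "card X - 1"] T_last card_pos by (simp add: alpha_max_def)
  moreover have alpha_max_bounds: "0 \<le> alpha_max X x p" "alpha_max X x p < 1"
    using T_ge_1[of "card X - 1"] T_last card_pos p1_pos
    by (auto simp: alpha_max_def)
  moreover have "is_optimal_code D X p L_lim (l_dagger D X x p (alpha_max X x p) k)"
    if L: "L_lim = - log (real D) (1 / real (card X))" and idx: "is_alpha_index X x p (alpha_max X x p) k" for k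
  proof -
    \<comment> \<open>Since \<open>alpha_max\<close> is the breakpoint preceding the final value 1,
      the tail set is all of \<open>X\<close> and the code is uniform.\<close>
    have "is_alpha_index X x p (alpha_max X x p) (card X - 1)"
      using card_pos alpha_max_eq alpha_max_bounds(2) alpha_seq_card
      by (simp add: is_alpha_index_def del: alpha_seq.simps)
    then have k: "k = card X - 1"
      using idx ex1_alpha_index[OF alpha_max_bounds] by blast
    have "1 / real (card X) = (1 - (1 - alpha_max X x p) * S k) / real (Suc k)"
      using card_pos S_last unfolding k by simp
    then show ?thesis
      using L by (intro l_dagger_optimal_of_index[OF assms(1) idx]) auto
  qed
  ultimately show ?thesis
    using ex1_alpha_index limited_code_lengths_empty[OF assms(1)] sum_p by simp
qed

end
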